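(* For each $i\in\{1,\dots,d\}$ let $\mu_i$ be a nice measure on $\mathbb{R}^d$ with support $K_i$. Assume the family $\mathcal{F}=\{K_1,\dots,K_d\}$ is well separated and let $\alpha=(\alpha_1,\dots,\alpha_d)\in[0,1]^d$. Then there is a unique positive transversal halfspace $H$ to $\mathcal{F}$ such that $\mu_i(K_i\cap H)=\alpha_i\cdot\mu_i(K_i)$ for every $i\in\{1,\dots,d\}$.
   Context: For a unit vector $v\in S^{d-1}$ and $t\in\mathbb{R}$ write $H(v\le t)=\{x\in\mathbb{R}^d:\langle x,v\rangle\le t\}$, $H(v=t)=\{x:\langle x,v\rangle=t\}$, and for $s_0\le s_1$ let $H(s_0\le v\le s_1)$ be the closed slab $\{x:s_0\le\langle x,v\rangle\le s_1\}$. For a finite Borel measure $\mu$ on $\mathbb{R}^d$ and $v\in S^{d-1}$ let $t_0(v)=\inf\{t:\mu(H(v\le t))>0\}$ and $t_1(v)=\sup\{t:\mu(H(v\le t))<\mu(\mathbb{R}^d)\}$ (possibly infinite). The support of $\mu$ is $K=\bigcap_{v\in S^{d-1}}H(t_0(v)\le v\le t_1(v))$. The measure $\mu$ is nice if (i) $t_0(v),t_1(v)$ are finite for all $v\in S^{d-1}$; (ii) $\mu(H(v=t))=0$ for all $v\in S^{d-1}$, $t\in\mathbb{R}$; (iii) $\mu(H(s_0\le v\le s_1))>0$ for all $v\in S^{d-1}$ and all $t_0(v)\le s_0<s_1\le t_1(v)$. A family $\mathcal{F}$ of connected sets in $\mathbb{R}^d$ is well separated if for any $k\le d+1$ distinct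 members $K_1,\dots,K_k$ and any points $x_i\in\mathrm{conv}\,K_i$, $\mathrm{aff}\{x_1,\dots,x_k\}$ is a $(k-1)$-dimensional flat. A hyperplane is transversal to $\mathcal{F}$ if it meets every member. For $a_i\in K_i$ ($i=1,\dots,d$), let $v(a_1,\dots,a_d)$ be the unique unit normal $v$ to the hyperplane $\mathrm{aff}\{a_1,\dots,a_d\}$ such that the $(d+1)\times(d+1)$ determinant with first row $(v,a_1,\dots,a_d)$ (columns) and last row $(0,1,\dots,1)$ is positive. For a hyperplane $L$ transversal to $\mathcal{F}$, pick $a_i\in K_i\cap L$; then $v=v(a_1,\dots,a_d)$ is independent of the choice, and writing $L=H(v=t)$, the halfspace $H(v\le t)$ is the positive transversal halfspace to $\mathcal{F}$ with bounding hyperplane $L$. *)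

theory Defs
  imports "Jordan_Normal_Form.Determinant" "HOL-Analysis.Analysis"
begin

(* Both parent libraries use these infixes; from here on they denote vec_nth and inner on real ^ 'n. *)
no_notation Matrix.vec_index (infixl \<open>$\<close> 100)
no_notation Matrix.scalar_prod (infix \<open>\<bullet>\<close> 70)

definition lower_halfspace :: "real ^ 'n \<Rightarrow> real \<Rightarrow> (real ^ 'n) set" where
  "lower_halfspace v t = {x. x \<bullet> v \<le> t}"

definition hyperplane :: "real ^ 'n \<Rightarrow> real \<Rightarrow> (real ^ 'n) set" where
  "hyperplane v t = {x. x \<bullet> v = t}"

(* The bounds are extended reals because the extents of a measure below may be infinite. *)
definition slab :: "real ^ 'n \<Rightarrow> ereal \<Rightarrow> ereal \<Rightarrow> (real ^ 'n) set" where
  "slab v s0 s1 = {x. s0 \<le> ereal (x \<bullet> v) \<and> ereal (x \<bullet> v) \<le> s1}"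

definition lower_extent :: "(real ^ 'n) measure \<Rightarrow> real ^ 'n \<Rightarrow> ereal" where
  "lower_extent \<mu> v = Inf (ereal ` {t. measure \<mu> (lower_halfspace v t) > 0})"

definition upper_extent :: "(real ^ 'n) measure \<Rightarrow> real ^ 'n \<Rightarrow> ereal" where
  "upper_extent \<mu> v = Sup (ereal ` {t. measure \<mu> (lower_halfspace v t) < measure \<mu> UNIV})"

(* The intersection of all supporting slabs; this is in general larger than the
   topological support of the measure. *)
definition support :: "(real ^ 'n) measure \<Rightarrow> (real ^ 'n) set" where
  "support \<mu> = (\<Inter>v \<in> sphere 0 1. slab v (lower_extent \<mu> v) (upper_extent \<mu> v))"

definition nice_measure :: "(real ^ 'n) measure \<Rightarrow> bool" where
  "nice_measure \<mu> \<longleftrightarrow>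
     finite_measure \<mu> \<and> sets \<mu> = sets borel \<and>
     (\<forall>v \<in> sphere 0 1. \<bar>lower_extent \<mu> v\<bar> \<noteq> \<infinity> \<and> \<bar>upper_extent \<mu> v\<bar> \<noteq> \<infinity>) \<and>
     (\<forall>v \<in> sphere 0 1. \<forall>t. measure \<mu> (hyperplane v t) = 0) \<and>
     (\<forall>v \<in> sphere 0 1. \<forall>s0 s1. lower_extent \<mu> v \<le> ereal s0 \<and> s0 < s1 \<and> ereal s1 \<le> upper_extent \<mu> v \<longrightarrow>
        measure \<mu> (slab v (ereal s0) (ereal s1)) > 0)"

(* Families are indexed, and "distinct members" means distinct indices: a set occurring twice in
   the family prevents it from being well separated. *)
definition well_separated :: "'i set \<Rightarrow> ('i \<Rightarrow> (real ^ 'n) set) \<Rightarrow> bool" where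
  "well_separated I K \<longleftrightarrow>
     (\<forall>i \<in> I. connected (K i)) \<and>
     (\<forall>J x. J \<subseteq> I \<and> finite J \<and> J \<noteq> {} \<and> card J \<le> CARD('n) + 1 \<and>
        (\<forall>j \<in> J. x j \<in> convex hull (K j)) \<longrightarrow>
        aff_dim (affine hull (x ` J)) = int (card J) - 1)"

definition transversal :: "(real ^ 'n) set \<Rightarrow> 'i set \<Rightarrow> ('i \<Rightarrow> (real ^ 'n) set) \<Rightarrow> bool" where
  "transversal L I K \<longleftrightarrow> (\<forall>i \<in> I. L \<inter> K i \<noteq> {})"

(* With d = CARD('n), this is the determinant of the (d+1) x (d+1) matrix

     [ v  a 1  ...  a d ]
     [ 0   1   ...   1  ]

   Its sign depends on an order of the coordinates of real ^ 'n, which the index type does not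
   provide: e lists them as e 1, ..., e d. Rows and columns of the matrix are numbered from 0. *)
definition orientation_det :: "(nat \<Rightarrow> 'n::finite) \<Rightarrow> real ^ 'n \<Rightarrow> (nat \<Rightarrow> real ^ 'n) \<Rightarrow> real" where
  "orientation_det e v a =
     Determinant.det (Matrix.mat (CARD('n) + 1) (CARD('n) + 1)
       (\<lambda>(r, c). if r < CARD('n)
                 then (if c = 0 then v else a c) $ e (r + 1)
                 else (if c = 0 then 0 else 1)))"

definition positive_normal :: "(nat \<Rightarrow> 'n::finite) \<Rightarrow> (nat \<Rightarrow> real ^ 'n) \<Rightarrow> real ^ 'n" where
  "positive_normal e a =
     (THE v. norm v = 1 \<and>
        (\<forall>x \<in> affine hull (a ` {1..CARD('n)}). \<forall>y \<in> affine hull (a ` {1..CARD('n)}). (x - y) \<bullet> v = 0) \<and>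
        orientation_det e v a > 0)"

(* For a well separated family K the normal does not depend on the points a i chosen in
   K i \<inter> L, so the existential choice of a is immaterial. *)
definition positive_transversal_halfspace ::
    "(nat \<Rightarrow> 'n::finite) \<Rightarrow> (nat \<Rightarrow> (real ^ 'n) set) \<Rightarrow> (real ^ 'n) set \<Rightarrow> bool" where
  "positive_transversal_halfspace e K H \<longleftrightarrow>
     (\<exists>v t a. norm v = 1 \<and>
        transversal (hyperplane v t) {1..CARD('n)} K \<and>
        (\<forall>i \<in> {1..CARD('n)}. a i \<in> K i \<inter> hyperplane v t) \<and>
        v = positive_normal e a \<and>
        H = lower_halfspace v t)"

end

(*
  Writing the orientation determinant as v . W(a), the vector W(a) is normal to all differences
  a i - a j, depends continuously on a, and is nonzero when the a i are affinely independent.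

  Existence: on the product of the supports K i, which are compact and convex, let N(x) be the
  unit vector in direction W(x) and move each x i by (alpha i * mu i(R^d) - mu i{y. y . N <= x i . N}) N,
  followed by the nearest point projection to K i. This map is continuous because hyperplanes are
  null sets, and the halfspace through the coordinates of a Brouwer fixed point solves the problem.

  Uniqueness: let f <= 0 and g <= 0 be two solutions, f = x . v - t and g = x . u - s. Since the
  two halfspaces have equal mu i-measure, each K i contains p i with f >= 0 >= g and q i with
  f <= 0 <= g. So every hyperplane of the pencil (1 - l) f = l g, 0 <= l <= 1, meets every K i, and
  for points x i of K i on it the product of its normal (1 - l) v - l u with W(x) is nonzero. The
  sign of this product is locally constant in l, but it is positive for l = 0 and negative for l = 1.
*)
theory Submission
  imports Defs
begin

section \<open>Nice measures and their supports\<close>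

locale nice =
  fixes \<mu> :: "(real ^ 'n::finite) measure"
  assumes nice: "nice_measure \<mu>"
begin

sublocale finite_measure \<mu>
  using nice by (simp add: nice_measure_def)

lemma sets_eq [measurable_cong, simp]: "sets \<mu> = sets borel"
  using nice by (simp add: nice_measure_def)

lemma space_eq [simp]: "space \<mu> = UNIV"
  using sets_eq_imp_space_eq[OF sets_eq] by simp

text \<open>The extents of a nice measure are finite in every unit direction, so they are handled as
  real numbers from here on.\<close>

definition lower :: "real ^ 'n \<Rightarrow> real" where
  "lower v = real_of_ereal (lower_extent \<mu> v)"

definition upper :: "real ^ 'n \<Rightarrow> real" where
  "upper v = real_of_ereal (upper_extent \<mu> v)"

lemma extent_finite:
  assumes "norm v = 1"
  shows "\<bar>lower_extent \<mu> v\<bar> \<noteq> \<infinity>" "\<bar>upper_extent \<mu> v\<bar> \<noteq> \<infinity>"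
proof -
  have "v \<in> sphere 0 1" using assms by simp
  then show "\<bar>lower_extent \<mu> v\<bar> \<noteq> \<infinity>" "\<bar>upper_extent \<mu> v\<bar> \<noteq> \<infinity>"
    using nice unfolding nice_measure_def by metis+
qed

lemma lower_extent_eq: "norm v = 1 \<Longrightarrow> lower_extent \<mu> v = ereal (lower v)"
  using extent_finite(1) by (simp add: lower_def ereal_real')

lemma upper_extent_eq: "norm v = 1 \<Longrightarrow> upper_extent \<mu> v = ereal (upper v)"
  using extent_finite(2) by (simp add: upper_def ereal_real')

lemma support_eq: "support \<mu> = (\<Inter>v \<in> sphere 0 1. {x. lower v \<le> x \<bullet> v \<and> x \<bullet> v \<le> upper v})"
  by (auto simp: support_def slab_def lower_extent_eq upper_extent_eq)

text \<open>Niceness speaks of unit normals only; dividing the equation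
  \<open>x \<bullet> v = t\<close> by \<open>norm v\<close> carries it over to every nonzero
  normal.\<close>

lemma hyperplane_null:
  assumes "v \<noteq> 0"
  shows "measure \<mu> {x. x \<bullet> v = t} = 0"
proof -
  have "{x. x \<bullet> v = t} = hyperplane (v /\<^sub>R norm v) (t / norm v)"
    using assms by (simp add: hyperplane_def inverse_eq_divide)
  moreover have "measure \<mu> (hyperplane (v /\<^sub>R norm v) (t / norm v)) = 0"
  proof -
    have "v /\<^sub>R norm v \<in> sphere 0 1" using assms by simp
    then show ?thesis using nice unfolding nice_measure_def by blast
  qed
  ultimately show ?thesis by simp
qed

lemma AE_not_hyperplane:
  assumes "v \<noteq> 0"
  shows "AE x in \<mu>. x \<bullet> v \<noteq> t"
  using hyperplane_null[OF assms, of t]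
  by (intro AE_I[where N = "{x. x \<bullet> v = t}"]) (auto simp: emeasure_eq_measure)

text \<open>By the definition of the infimum, every halfspace at a level below the extent is null.
  Rational levels suffice, so countably many null sets cover all \<open>x\<close> with
  \<open>x \<bullet> v < lower v\<close>.\<close>

lemma AE_lower:
  assumes "norm v = 1"
  shows "AE x in \<mu>. lower v \<le> x \<bullet> v"
proof -
  have "AE x in \<mu>. \<not> x \<bullet> v \<le> q" if "q < lower v" for q
  proof -
    have "measure \<mu> (lower_halfspace v q) = 0"
    proof (rule ccontr)
      assume "measure \<mu> (lower_halfspace v q) \<noteq> 0"
      then have "lower_extent \<mu> v \<le> ereal q"
        unfolding lower_extent_def using measure_nonneg[of \<mu>]
        by (intro Inf_lower) (auto simp: less_le)
      with that show False by (simp add: lower_extent_eq[OF assms])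
    qed
    then show ?thesis
      by (intro AE_I[where N = "lower_halfspace v q"])
         (auto simp: emeasure_eq_measure lower_halfspace_def)
  qed
  then have "AE x in \<mu>. \<forall>q \<in> {q \<in> \<rat>. q < lower v}. \<not> x \<bullet> v \<le> q"
    by (subst AE_ball_countable) (auto intro: countable_subset[OF _ countable_rat])
  then show ?thesis
  proof eventually_elim
    case (elim x)
    show ?case
    proof (rule ccontr)
      assume "\<not> ?thesis"
      then obtain q where "q \<in> \<rat>" "x \<bullet> v < q" "q < lower v"
        using Rats_dense_in_real[of "x \<bullet> v" "lower v"] by auto
      with elim show False by auto
    qed
  qed
qed

text \<open>Dually, a halfspace at a level above the extent has full measure, so its complement is
  null, and rational levels suffice.\<close>

lemma AE_upper:
  assumes "norm v = 1"
  shows "AE x in \<mu>. x \<bullet> v \<le> upper v"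
proof -
  have "AE x in \<mu>. x \<bullet> v \<le> q" if "upper v < q" for q
  proof -
    have "measure \<mu> (lower_halfspace v q) = measure \<mu> UNIV"
    proof (rule ccontr)
      assume "measure \<mu> (lower_halfspace v q) \<noteq> measure \<mu> UNIV"
      moreover have "measure \<mu> (lower_halfspace v q) \<le> measure \<mu> UNIV"
        using bounded_measure[of "lower_halfspace v q"] by simp
      ultimately have "ereal q \<le> upper_extent \<mu> v"
        unfolding upper_extent_def by (intro Sup_upper) auto
      with that show False by (simp add: upper_extent_eq[OF assms])
    qed
    then have "AE x in \<mu>. x \<in> lower_halfspace v q"
      using finite_measure_compl[of "lower_halfspace v q"]
      by (intro AE_I[where N = "- lower_halfspace v q"])
         (auto simp: emeasure_eq_measure lower_halfspace_def Compl_eq_Diff_UNIV)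
    then show ?thesis by (simp add: lower_halfspace_def)
  qed
  then have "AE x in \<mu>. \<forall>q \<in> {q \<in> \<rat>. upper v < q}. x \<bullet> v \<le> q"
    by (subst AE_ball_countable) (auto intro: countable_subset[OF _ countable_rat])
  then show ?thesis
  proof eventually_elim
    case (elim x)
    show ?case
    proof (rule ccontr)
      assume "\<not> ?thesis"
      then obtain q where "q \<in> \<rat>" "upper v < q" "q < x \<bullet> v"
        using Rats_dense_in_real[of "upper v" "x \<bullet> v"] by auto
      with elim show False by auto
    qed
  qed
qed

text \<open>The complement of the support is a union of null open sets over uncountably many
  directions. The Lindelof property leaves a countable subfamily with the same union.\<close>

lemma AE_support: "AE x in \<mu>. x \<in> support \<mu>"
proof -
  define U where "U v = {x. x \<bullet> v < lower v} \<union> {x. upper v < x \<bullet> v}" for v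
  have "open S" if "S \<in> U ` sphere 0 1" for S
    using that by (auto simp: U_def intro!: open_Un open_Collect_less continuous_intros)
  then obtain F where F: "F \<subseteq> U ` sphere 0 1" "countable F" "\<Union>F = \<Union>(U ` sphere 0 1)"
    by (rule Lindelof)
  have "AE x in \<mu>. x \<notin> U v" if "v \<in> sphere 0 1" for v
    using AE_lower[of v] AE_upper[of v] that by (auto simp: U_def)
  then have "AE x in \<mu>. \<forall>S \<in> F. x \<notin> S"
    using F by (subst AE_ball_countable) auto
  then show ?thesis
  proof eventually_elim
    case (elim x)
    then have "x \<notin> \<Union>(U ` sphere 0 1)" using F by auto
    then show ?case by (force simp: U_def support_eq)
  qed
qed

lemma convex_support: "convex (support \<mu>)"
proof -
  have "convex {x. lower v \<le> x \<bullet> v \<and> x \<bullet> v \<le> upper v}" for v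
  proof -
    have "{x. lower v \<le> x \<bullet> v \<and> x \<bullet> v \<le> upper v} = {x. v \<bullet> x \<ge> lower v} \<inter> {x. v \<bullet> x \<le> upper v}"
      by (auto simp: inner_commute)
    then show ?thesis
      by (simp only: convex_Int convex_halfspace_ge convex_halfspace_le)
  qed
  then show ?thesis unfolding support_eq by (intro convex_INT)
qed

lemma closed_support: "closed (support \<mu>)"
  unfolding support_eq
proof (intro closed_INT ballI)
  fix v
  show "closed {x. lower v \<le> x \<bullet> v \<and> x \<bullet> v \<le> upper v}"
    by (intro closed_Collect_conj closed_Collect_le continuous_intros)
qed

text \<open>The slabs in the coordinate directions alone enclose the support in a box.\<close>

lemma compact_support: "compact (support \<mu>)"
proof -
  have "support \<mu> \<subseteq> cbox (\<chi> i. lower (axis i 1)) (\<chi> i. upper (axis i 1))"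
  proof
    fix x assume "x \<in> support \<mu>"
    then have "lower (axis i 1) \<le> x \<bullet> axis i 1 \<and> x \<bullet> axis i 1 \<le> upper (axis i 1)" for i
      by (simp add: support_eq)
    then show "x \<in> cbox (\<chi> i. lower (axis i 1)) (\<chi> i. upper (axis i 1))"
      by (simp add: mem_box_cart inner_axis)
  qed
  then show ?thesis
    using closed_support bounded_cbox bounded_subset compact_eq_bounded_closed by blast
qed

text \<open>The support carries all the mass, so measures of halfspaces can be computed without
  intersecting with it.\<close>

lemma measure_support_Int:
  assumes "A \<in> sets borel"
  shows "measure \<mu> (support \<mu> \<inter> A) = measure \<mu> A"
  using assms closed_support AE_support by (intro measure_eq_AE) auto

lemma measure_support: "measure \<mu> (support \<mu>) = measure \<mu> UNIV"
  using measure_support_Int[of UNIV] by simp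

text \<open>For the zero measure the lower extent would be the infimum of the empty set, which is
  infinite.\<close>

lemma measure_UNIV_pos: "0 < measure \<mu> UNIV"
proof (rule ccontr)
  assume "\<not> ?thesis"
  then have "measure \<mu> A = 0" for A
    using bounded_measure[of A] measure_nonneg[of \<mu> A] by (intro antisym) auto
  then have "lower_extent \<mu> v = \<infinity>" for v
    by (simp add: lower_extent_def top_ereal_def)
  then show False
    using extent_finite(1)[of "axis undefined 1"] by simp
qed

lemma support_nonempty: "support \<mu> \<noteq> {}"
  using measure_UNIV_pos measure_support by auto

text \<open>Since \<open>a\<close> and \<open>b\<close> lie strictly on either side of the level
  \<open>c\<close>, the interval from \<open>a \<bullet> w\<close> to \<open>b \<bullet> w\<close>
  meets the interval of radius \<open>\<epsilon>\<close> about \<open>c\<close> in more than a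
  point. After normalising \<open>w\<close> it lies within the extents, so the positivity of slabs
  applies.\<close>

lemma measure_slab_pos:
  assumes "a \<in> support \<mu>" "b \<in> support \<mu>" "a \<bullet> w < c" "c < b \<bullet> w" "0 < \<epsilon>"
  shows "0 < measure \<mu> {x. \<bar>x \<bullet> w - c\<bar> \<le> \<epsilon>}"
proof -
  have "w \<noteq> 0" using assms by auto
  define v where "v = w /\<^sub>R norm w"
  have v: "norm v = 1" and n: "0 < norm w" using \<open>w \<noteq> 0\<close> by (auto simp: v_def)
  have w: "x \<bullet> v = (x \<bullet> w) / norm w" for x by (simp add: v_def field_simps)
  define s0 s1 where "s0 = max (a \<bullet> v) ((c - \<epsilon>) / norm w)" and "s1 = min (b \<bullet> v) ((c + \<epsilon>) / norm w)"
  have "lower v \<le> a \<bullet> v" "b \<bullet> v \<le> upper v"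
    using assms v by (auto simp: support_eq)
  then have "lower_extent \<mu> v \<le> ereal s0" "ereal s1 \<le> upper_extent \<mu> v"
    by (auto simp: lower_extent_eq upper_extent_eq v s0_def s1_def simp flip: ereal_max ereal_min)
  have "s0 < s1"
    using assms n by (auto simp: s0_def s1_def w divide_strict_right_mono)
  have "0 < measure \<mu> (slab v (ereal s0) (ereal s1))"
  proof -
    have "v \<in> sphere 0 1" using v by simp
    then show ?thesis using nice \<open>s0 < s1\<close> \<open>lower_extent \<mu> v \<le> ereal s0\<close> \<open>ereal s1 \<le> upper_extent \<mu> v\<close>
      unfolding nice_measure_def by blast
  qed
  also have "\<dots> \<le> measure \<mu> {x. \<bar>x \<bullet> w - c\<bar> \<le> \<epsilon>}"
  proof (rule finite_measure_mono)
    show "slab v (ereal s0) (ereal s1) \<subseteq> {x. \<bar>x \<bullet> w - c\<bar> \<le> \<epsilon>}"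
      using n by (auto simp: slab_def s0_def s1_def w divide_le_cancel abs_le_iff)
  qed auto
  finally show ?thesis .
qed

text \<open>Dominated convergence: along a convergent sequence the indicators of the halfspaces are
  eventually constant at each point off the limiting hyperplane, which is null.\<close>

lemma continuous_on_measure_lower_halfspace:
  fixes f :: "'b::metric_space \<Rightarrow> real ^ 'n"
  assumes f: "continuous_on S f" and g: "continuous_on S g" and nz: "\<And>y. y \<in> S \<Longrightarrow> f y \<noteq> 0"
  shows "continuous_on S (\<lambda>y. measure \<mu> (lower_halfspace (f y) (g y)))"
  unfolding continuous_on_sequentially o_def
proof (intro allI ballI impI)
  fix z y assume y: "y \<in> S" and z: "(\<forall>n. z n \<in> S) \<and> z \<longlonglongrightarrow> y"
  have fz: "(\<lambda>n. f (z n)) \<longlonglongrightarrow> f y" and gz: "(\<lambda>n. g (z n)) \<longlonglongrightarrow> g y"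
    using f g y z by (auto simp: continuous_on_sequentially o_def)
  let ?I = "\<lambda>y. indicat_real (lower_halfspace (f y) (g y))"
  have meas: "lower_halfspace v t \<in> sets borel" for v :: "real ^ 'n" and t
    by (simp add: lower_halfspace_def)
  have "(\<lambda>n. \<integral>x. ?I (z n) x \<partial>\<mu>) \<longlonglongrightarrow> (\<integral>x. ?I y x \<partial>\<mu>)"
  proof (rule integral_dominated_convergence[where w = "\<lambda>_. 1"])
    show "AE x in \<mu>. (\<lambda>n. ?I (z n) x) \<longlonglongrightarrow> ?I y x"
      using AE_not_hyperplane[OF nz[OF y], of "g y"]
    proof eventually_elim
      case (elim x)
      have lim: "(\<lambda>n. x \<bullet> f (z n) - g (z n)) \<longlonglongrightarrow> x \<bullet> f y - g y"
        by (intro tendsto_intros fz gz)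
      have "\<forall>\<^sub>F n in sequentially. ?I (z n) x = ?I y x"
      proof (cases "x \<bullet> f y < g y")
        case True
        then have "\<forall>\<^sub>F n in sequentially. x \<bullet> f (z n) - g (z n) < 0"
          using order_tendstoD(2)[OF lim, of 0] by simp
        then show ?thesis by eventually_elim (use True in \<open>auto simp: lower_halfspace_def indicator_def\<close>)
      next
        case False
        then have *: "g y < x \<bullet> f y" using elim by simp
        then have "\<forall>\<^sub>F n in sequentially. 0 < x \<bullet> f (z n) - g (z n)"
          using order_tendstoD(1)[OF lim, of 0] by simp
        then show ?thesis by eventually_elim (use * in \<open>auto simp: lower_halfspace_def indicator_def\<close>)
      qed
      then show ?case by (rule tendsto_eventually)
    qed
  qed (use meas in \<open>auto simp: indicator_def\<close>)
  then show "(\<lambda>n. measure \<mu> (lower_halfspace (f (z n)) (g (z n)))) \<longlonglongrightarrow> measure \<mu> (lower_halfspace (f y) (g y))"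
    by simp
qed

text \<open>Otherwise, by compactness, the slab \<open>\<bar>(x \<bullet> v - t) + (x \<bullet> u - s)\<bar> \<le> \<epsilon>\<close> lies, within the support,
  in the set where \<open>x \<bullet> v < t\<close> and \<open>x \<bullet> u > s\<close>. That set is null, but the slab has positive
  measure since it separates \<open>a\<close> from \<open>b\<close>.\<close>
lemma exists_support_between:
  assumes v: "v \<noteq> 0" and u: "u \<noteq> 0"
    and a: "a \<in> support \<mu>" "a \<bullet> v = t" and b: "b \<in> support \<mu>" "b \<bullet> u = s"
    and eq: "measure \<mu> (lower_halfspace v t) = measure \<mu> (lower_halfspace u s)"
  shows "\<exists>p \<in> support \<mu>. t \<le> p \<bullet> v \<and> p \<bullet> u \<le> s"
proof (rule ccontr)
  let ?K = "support \<mu>"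
  assume "\<not> ?thesis"
  then have no: "p \<bullet> v < t \<or> s < p \<bullet> u" if "p \<in> ?K" for p
    using that by force
  define F where "F = ?K \<inter> {x. t \<le> x \<bullet> v}"
  define G where "G = ?K \<inter> {x. x \<bullet> u \<le> s}"
  have cF: "compact F" and cG: "compact G"
    unfolding F_def G_def
    by (auto intro!: compact_Int_closed compact_support closed_Collect_le continuous_intros)
  have "a \<in> F" "b \<in> G" using a b by (auto simp: F_def G_def)
  have cont: "continuous_on S (\<lambda>x. x \<bullet> w)" for S and w :: "real ^ 'n"
    by (intro continuous_intros)
  obtain x1 where x1: "x1 \<in> F" "\<And>x. x \<in> F \<Longrightarrow> x1 \<bullet> u \<le> x \<bullet> u"
    using continuous_attains_inf[OF cF _ cont, of u] \<open>a \<in> F\<close> by blast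
  obtain x2 where x2: "x2 \<in> G" "\<And>x. x \<in> G \<Longrightarrow> x \<bullet> v \<le> x2 \<bullet> v"
    using continuous_attains_sup[OF cG _ cont, of v] \<open>b \<in> G\<close> by blast
  \<comment> \<open>Half of the smaller gap. On \<open>F\<close> the sum
    \<open>(x \<bullet> v - t) + (x \<bullet> u - s)\<close> exceeds \<open>\<epsilon>\<close>, and
    on \<open>G\<close> it is below \<open>- \<epsilon>\<close>, so the slab avoids both
    sets.\<close>
  define \<epsilon> where "\<epsilon> = min (x1 \<bullet> u - s) (t - x2 \<bullet> v) / 2"
  have pos: "0 < x1 \<bullet> u - s" "0 < t - x2 \<bullet> v"
    using no[of x1] no[of x2] x1 x2 by (auto simp: F_def G_def)
  then have \<epsilon>: "0 < \<epsilon>" "\<epsilon> < x1 \<bullet> u - s" "\<epsilon> < t - x2 \<bullet> v" by (auto simp: \<epsilon>_def min_def)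
  have "s < a \<bullet> u" "b \<bullet> v < t" using no[of a] no[of b] a b by auto
  then have "0 < measure \<mu> {x. \<bar>x \<bullet> (v + u) - (t + s)\<bar> \<le> \<epsilon>}"
    using a b \<epsilon> by (intro measure_slab_pos[of b a]) (auto simp: inner_add_right)
  also have "\<dots> = measure \<mu> (?K \<inter> {x. \<bar>x \<bullet> (v + u) - (t + s)\<bar> \<le> \<epsilon>})"
    by (rule measure_support_Int[symmetric]) simp
  also have "\<dots> \<le> measure \<mu> (lower_halfspace v t - lower_halfspace u s)"
  proof (rule finite_measure_mono)
    show "?K \<inter> {x. \<bar>x \<bullet> (v + u) - (t + s)\<bar> \<le> \<epsilon>} \<subseteq> lower_halfspace v t - lower_halfspace u s"
    proof
      fix x assume x: "x \<in> ?K \<inter> {x. \<bar>x \<bullet> (v + u) - (t + s)\<bar> \<le> \<epsilon>}"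
      then have e: "\<bar>(x \<bullet> v - t) + (x \<bullet> u - s)\<bar> \<le> \<epsilon>" "x \<in> ?K"
        by (auto simp: inner_add_right algebra_simps)
      have "x \<notin> F" using x1(2)[of x] e \<epsilon> by (auto simp: F_def)
      moreover have "x \<notin> G" using x2(2)[of x] e \<epsilon> by (auto simp: G_def)
      ultimately show "x \<in> lower_halfspace v t - lower_halfspace u s"
        using e by (auto simp: F_def G_def lower_halfspace_def)
    qed
  qed (auto simp: lower_halfspace_def)
  also have "\<dots> = measure \<mu> (lower_halfspace v t) - measure \<mu> (lower_halfspace v t \<inter> lower_halfspace u s)"
    by (rule finite_measure_Diff') (auto simp: lower_halfspace_def)
  \<comment> \<open>On the support \<open>x \<bullet> u \<le> s\<close> forces
    \<open>x \<bullet> v < t\<close>. Up to a null set the second halfspace is thus contained in the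
    first, and equal measures make the difference null.\<close>
  also have "measure \<mu> (lower_halfspace v t \<inter> lower_halfspace u s) = measure \<mu> (lower_halfspace u s)"
  proof (rule measure_eq_AE)
    show "AE x in \<mu>. x \<in> lower_halfspace v t \<inter> lower_halfspace u s \<longleftrightarrow> x \<in> lower_halfspace u s"
      using AE_support
    proof eventually_elim
      case (elim x) then show ?case using no[of x] by (auto simp: lower_halfspace_def)
    qed
  qed (auto simp: lower_halfspace_def)
  finally show False using eq by simp
qed

end

section \<open>Affine independence of families and compactness of products\<close>

lemma sum_lessThan_Suc_split_0:
  fixes f :: "nat \<Rightarrow> 'a::comm_monoid_add"
  shows "(\<Sum>i = 0..<Suc n. f i) = f 0 + (\<Sum>i = 1..n. f i)"
  by (simp add: atLeastLessThanSuc_atLeastAtMost sum.atLeast_Suc_atMost)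

text \<open>Maximal affine dimension rules out repeated points, so \<open>a\<close> is injective on
  \<open>I\<close> and the coefficients can be transported to the set of points, where a nonzero one
  would give an affine dependence.\<close>

lemma affinely_independent_family:
  fixes a :: "'i \<Rightarrow> 'a::euclidean_space"
  assumes "finite I" and "aff_dim (a ` I) = int (card I) - 1"
    and sum: "(\<Sum>i\<in>I. c i) = 0" "(\<Sum>i\<in>I. c i *\<^sub>R a i) = 0" and "i \<in> I"
  shows "c i = 0"
proof (rule ccontr)
  assume "c i \<noteq> 0"
  have "int (card I) - 1 \<le> int (card (a ` I)) - 1"
    using aff_dim_le_card[of "a ` I"] assms by simp
  then have card: "card (a ` I) = card I"
    using card_image_le[OF \<open>finite I\<close>, of a] by simp
  then have inj: "inj_on a I"
    using \<open>finite I\<close> eq_card_imp_inj_on by blast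
  have "\<not> affine_dependent (a ` I)"
    using assms card by (simp add: affine_independent_iff_card)
  moreover have "affine_dependent (a ` I)"
    unfolding affine_dependent_explicit_finite[OF finite_imageI[OF \<open>finite I\<close>]]
    by (rule exI[where x = "c \<circ> inv_into I a"])
       (use inj sum \<open>i \<in> I\<close> \<open>c i \<noteq> 0\<close> in \<open>auto simp: sum.reindex\<close>)
  ultimately show False by simp
qed

text \<open>Heine-Borel: the product is closed, and the norm is at most the sum of the bounds of the
  components.\<close>

lemma compact_vec_product:
  fixes C :: "'n::finite \<Rightarrow> 'a::euclidean_space set"
  assumes "\<And>k. compact (C k)"
  shows "compact {x :: 'a ^ 'n. \<forall>k. x $ k \<in> C k}"
  unfolding compact_eq_bounded_closed
proof
  show "closed {x :: 'a ^ 'n. \<forall>k. x $ k \<in> C k}"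
    using assms by (intro closed_vector_box) (simp add: compact_imp_closed)
  have "\<forall>k. \<exists>b. \<forall>y \<in> C k. norm y \<le> b"
    using compact_imp_bounded[OF assms] by (simp add: bounded_iff)
  then obtain b where b: "\<And>k y. y \<in> C k \<Longrightarrow> norm y \<le> b k" by metis
  have "norm x \<le> sum b UNIV" if "\<forall>k. x $ k \<in> C k" for x :: "'a ^ 'n"
  proof -
    have "norm x \<le> (\<Sum>k\<in>UNIV. norm (x $ k))"
      unfolding norm_vec_def by (rule L2_set_le_sum) simp
    also have "\<dots> \<le> sum b UNIV"
      using that b by (intro sum_mono) simp
    finally show ?thesis .
  qed
  then show "bounded {x :: 'a ^ 'n. \<forall>k. x $ k \<in> C k}"
    unfolding bounded_iff by blast
qed

section \<open>The orientation determinant and the positive normal\<close>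

locale coordinate_order =
  fixes e :: "nat \<Rightarrow> 'n::finite"
  assumes bij: "bij_betw e {1..CARD('n)} UNIV"
begin

definition orientation_mat :: "real ^ 'n \<Rightarrow> (nat \<Rightarrow> real ^ 'n) \<Rightarrow> real mat" where
  "orientation_mat v a = Matrix.mat (CARD('n) + 1) (CARD('n) + 1)
       (\<lambda>(r, c). if r < CARD('n)
                 then (if c = 0 then v else a c) $ e (r + 1)
                 else (if c = 0 then 0 else 1))"

lemma orientation_mat_carrier [simp]:
  "orientation_mat v a \<in> carrier_mat (CARD('n) + 1) (CARD('n) + 1)"
  by (simp add: orientation_mat_def)

lemma orientation_det_eq: "orientation_det e v a = Determinant.det (orientation_mat v a)"
  by (simp add: orientation_det_def orientation_mat_def)

text \<open>Inverse of the enumeration \<open>e\<close>. It allows a tuple numbered from 1 to d to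
  be stored as a vector over the index type.\<close>

definition index :: "'n \<Rightarrow> nat" where
  "index = inv_into {1..CARD('n)} e"

lemma index: "index k \<in> {1..CARD('n)}" "e (index k) = k"
proof -
  have "k \<in> e ` {1..CARD('n)}" unfolding bij_betw_imp_surj_on[OF bij] by (rule UNIV_I)
  then show "index k \<in> {1..CARD('n)}" "e (index k) = k"
    unfolding index_def by (rule inv_into_into, rule f_inv_into_f)
qed

lemma index_e: "i \<in> {1..CARD('n)} \<Longrightarrow> index (e i) = i"
  unfolding index_def by (rule bij_betw_inv_into_left[OF bij])

text \<open>Laplace expansion along column 0, whose cofactors do not involve
  \<open>v\<close>.\<close>

lemma linear_orientation_det: "linear (\<lambda>v. orientation_det e v a)"
proof -
  define C where "C r = cofactor (orientation_mat 0 a) r 0" for r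
  have C: "cofactor (orientation_mat v a) r 0 = C r" for v r
  proof -
    have "mat_delete (orientation_mat v a) r 0 = mat_delete (orientation_mat 0 a) r 0"
      by (rule eq_matI) (auto simp: mat_delete_def orientation_mat_def)
    then show ?thesis by (simp add: C_def cofactor_def)
  qed
  have "orientation_det e v a = (\<Sum>r<CARD('n). v $ e (Suc r) * C r)" for v
  proof -
    have "orientation_det e v a = (\<Sum>r<CARD('n) + 1. orientation_mat v a $$ (r, 0) * C r)"
      unfolding orientation_det_eq
      by (subst laplace_expansion_column[OF orientation_mat_carrier, of 0]) (simp_all add: C)
    also have "\<dots> = (\<Sum>r<CARD('n). orientation_mat v a $$ (r, 0) * C r)"
      by (simp add: orientation_mat_def)
    also have "\<dots> = (\<Sum>r<CARD('n). v $ e (Suc r) * C r)"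
      by (intro sum.cong) (simp_all add: orientation_mat_def)
    finally show ?thesis .
  qed
  then show ?thesis
    by (intro linearI) (simp_all add: distrib_right sum.distrib sum_distrib_left mult.assoc)
qed

text \<open>The vector that represents the linear functional \<open>orientation_det e v a\<close> of
  \<open>v\<close> through the inner product; up to sign, the generalised cross product of the
  differences \<open>a i - a 1\<close>.\<close>

definition wedge :: "(nat \<Rightarrow> real ^ 'n) \<Rightarrow> real ^ 'n" where
  "wedge a = (\<chi> k. orientation_det e (axis k 1) a)"

lemma orientation_det_eq_inner: "orientation_det e v a = v \<bullet> wedge a"
proof -
  interpret linear "\<lambda>v. orientation_det e v a" by (rule linear_orientation_det)
  have "orientation_det e v a = orientation_det e (\<Sum>k\<in>UNIV. v $ k *\<^sub>R axis k 1) a"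
    by (simp add: basis_expansion flip: scalar_mult_eq_scaleR)
  also have "\<dots> = v \<bullet> wedge a"
    by (simp add: sum scale inner_vec_def wedge_def)
  finally show ?thesis .
qed

text \<open>The coefficients \<open>c\<close> form a nonzero kernel vector of the matrix. Its first
  d rows give the vector equation, and its last row the vanishing sum, without \<open>c 0\<close>
  because column 0 ends in 0.\<close>

lemma orientation_det_eq_0_iff:
  "orientation_det e v a = 0 \<longleftrightarrow>
    (\<exists>c. (\<exists>i \<le> CARD('n). c i \<noteq> 0) \<and> c 0 *\<^sub>R v + (\<Sum>i = 1..CARD('n). c i *\<^sub>R a i) = 0 \<and>
         (\<Sum>i = 1..CARD('n). c i) = 0)"
proof -
  let ?d = "CARD('n)" and ?M = "orientation_mat v a"
  have entry: "vec_index (?M *\<^sub>v w) r =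
      (if r < ?d then vec_index w 0 * v $ e (Suc r) + (\<Sum>i = 1..?d. vec_index w i * a i $ e (Suc r))
       else (\<Sum>i = 1..?d. vec_index w i))"
    if "w \<in> carrier_vec (?d + 1)" "r < ?d + 1" for w r
  proof -
    have "vec_index (?M *\<^sub>v w) r = (\<Sum>i = 0..<Suc ?d. ?M $$ (r, i) * vec_index w i)"
      using that by (simp add: scalar_prod_def orientation_mat_def)
    also have "\<dots> = ?M $$ (r, 0) * vec_index w 0 + (\<Sum>i = 1..?d. ?M $$ (r, i) * vec_index w i)"
      by (rule sum_lessThan_Suc_split_0)
    finally show ?thesis
      using that by (auto simp: orientation_mat_def mult.commute intro!: sum.cong)
  qed
  \<comment> \<open>Rows are numbered from 0 but coordinates from 1, hence the shift by
    \<open>Suc\<close>.\<close>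
  have all_e: "(\<forall>r < ?d. P (e (Suc r))) \<longleftrightarrow> (\<forall>k. P k)" for P
  proof -
    have "(\<forall>r < ?d. P (e (Suc r))) \<longleftrightarrow> (\<forall>i \<in> {1..?d}. P (e i))"
      by (auto simp: Suc_le_eq) (metis Suc_pred Suc_le_eq less_eq_Suc_le)
    also have "\<dots> \<longleftrightarrow> (\<forall>k \<in> e ` {1..?d}. P k)" by blast
    finally show ?thesis
      unfolding bij_betw_imp_surj_on[OF bij] by simp
  qed
  have zero: "?M *\<^sub>v w = 0\<^sub>v (?d + 1) \<longleftrightarrow>
      vec_index w 0 *\<^sub>R v + (\<Sum>i = 1..?d. vec_index w i *\<^sub>R a i) = 0 \<and> (\<Sum>i = 1..?d. vec_index w i) = 0"
    if w: "w \<in> carrier_vec (?d + 1)" for w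
  proof -
    have "?M *\<^sub>v w = 0\<^sub>v (?d + 1) \<longleftrightarrow> (\<forall>r < ?d + 1. vec_index (?M *\<^sub>v w) r = 0)"
      by (auto simp: Matrix.vec_eq_iff orientation_mat_def)
    also have "\<dots> \<longleftrightarrow> (\<forall>r < ?d. vec_index w 0 * v $ e (Suc r) + (\<Sum>i = 1..?d. vec_index w i * a i $ e (Suc r)) = 0)
        \<and> (\<Sum>i = 1..?d. vec_index w i) = 0"
      using entry[OF w] by (auto simp: less_Suc_eq)
    also have "\<dots> \<longleftrightarrow> vec_index w 0 *\<^sub>R v + (\<Sum>i = 1..?d. vec_index w i *\<^sub>R a i) = 0 \<and> (\<Sum>i = 1..?d. vec_index w i) = 0"
      unfolding all_e[of "\<lambda>k. vec_index w 0 * v $ k + (\<Sum>i = 1..?d. vec_index w i * a i $ k) = 0"]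
      by (simp add: Finite_Cartesian_Product.vec_eq_iff sum_component)
    finally show ?thesis .
  qed
  have "orientation_det e v a = 0 \<longleftrightarrow>
      (\<exists>w. w \<in> carrier_vec (?d + 1) \<and> w \<noteq> 0\<^sub>v (?d + 1) \<and> ?M *\<^sub>v w = 0\<^sub>v (?d + 1))"
    unfolding orientation_det_eq by (rule det_0_iff_vec_prod_zero_field) (rule orientation_mat_carrier)
  also have "\<dots> \<longleftrightarrow> (\<exists>c. (\<exists>i \<le> ?d. c i \<noteq> 0) \<and> c 0 *\<^sub>R v + (\<Sum>i = 1..?d. c i *\<^sub>R a i) = 0 \<and>
         (\<Sum>i = 1..?d. c i) = 0)" (is "?L \<longleftrightarrow> ?R")
  proof
    assume ?L
    then obtain w where w: "w \<in> carrier_vec (?d + 1)" "w \<noteq> 0\<^sub>v (?d + 1)" "?M *\<^sub>v w = 0\<^sub>v (?d + 1)"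
      by blast
    have "\<exists>i \<le> ?d. vec_index w i \<noteq> 0"
      using w(1,2) by (auto simp: Matrix.vec_eq_iff less_Suc_eq_le)
    then show ?R using zero[OF w(1)] w(3) by blast
  next
    assume ?R
    then obtain c where c: "\<exists>i \<le> ?d. c i \<noteq> 0"
      "c 0 *\<^sub>R v + (\<Sum>i = 1..?d. c i *\<^sub>R a i) = 0" "(\<Sum>i = 1..?d. c i) = 0" by blast
    define w where "w = Matrix.vec (?d + 1) c"
    have w: "w \<in> carrier_vec (?d + 1)" by (simp add: w_def)
    have wi: "vec_index w i = c i" if "i \<le> ?d" for i
      using that by (simp add: w_def)
    have "w \<noteq> 0\<^sub>v (?d + 1)" using c(1) wi by (auto simp: Matrix.vec_eq_iff less_Suc_eq_le)
    moreover have "(\<Sum>i = 1..?d. vec_index w i *\<^sub>R a i) = (\<Sum>i = 1..?d. c i *\<^sub>R a i)"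
      and "(\<Sum>i = 1..?d. vec_index w i) = (\<Sum>i = 1..?d. c i)"
      by (auto intro: sum.cong simp: wi)
    then have "?M *\<^sub>v w = 0\<^sub>v (?d + 1)"
      unfolding zero[OF w] using c(2,3) wi[of 0] by simp
    ultimately show ?L using w by metis
  qed
  finally show ?thesis .
qed

text \<open>Only the columns numbered 1 to d are read, so a tuple may be replaced by the one
  recovered from its vector encoding.\<close>

lemma wedge_cong:
  assumes "\<And>i. i \<in> {1..CARD('n)} \<Longrightarrow> a i = b i"
  shows "wedge a = wedge b"
proof -
  have "orientation_mat v a = orientation_mat v b" for v
    using assms by (intro eq_matI) (auto simp: orientation_mat_def)
  then show ?thesis by (simp add: wedge_def orientation_det_eq)
qed

text \<open>With \<open>a i - a j\<close> in the place of \<open>v\<close>, column 0 of the matrix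
  is the difference of columns \<open>i\<close> and \<open>j\<close>.\<close>

lemma inner_wedge_diff:
  assumes "i \<in> {1..CARD('n)}" "j \<in> {1..CARD('n)}"
  shows "(a i - a j) \<bullet> wedge a = 0"
proof -
  \<comment> \<open>For \<open>i = j\<close> the two indicators cancel, and the relation says that
    column 0 is zero.\<close>
  define c where "c k = (if k = 0 then 1 else (if k = j then 1 else 0) - (if k = i then 1 else 0 :: real))" for k :: nat
  have "(\<Sum>k = 1..CARD('n). c k *\<^sub>R a k)
      = (\<Sum>k = 1..CARD('n). (if k = j then a k else 0) - (if k = i then a k else 0))"
    by (intro sum.cong) (auto simp: c_def)
  also have "\<dots> = a j - a i"
    using assms by (simp add: sum_subtractf sum.delta)
  finally have 1: "(\<Sum>k = 1..CARD('n). c k *\<^sub>R a k) = a j - a i" .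
  have "(\<Sum>k = 1..CARD('n). c k)
      = (\<Sum>k = 1..CARD('n). (if k = j then 1 else 0) - (if k = i then 1 else 0))"
    by (intro sum.cong) (auto simp: c_def)
  also have "\<dots> = 0"
    using assms by (simp add: sum_subtractf sum.delta)
  finally have 2: "(\<Sum>k = 1..CARD('n). c k) = 0" .
  have "c 0 = 1" by (simp add: c_def)
  then have "orientation_det e (a i - a j) a = 0"
    unfolding orientation_det_eq_0_iff using 1 2 by (intro exI[of _ c]) auto
  then show ?thesis by (simp add: orientation_det_eq_inner)
qed

text \<open>Otherwise there is a linear relation between the columns. Its product with
  \<open>v\<close> leaves \<open>c 0 * (v \<bullet> v) = 0\<close>, since all points have the same
  level \<open>t\<close> and their coefficients sum to 0. What remains is an affine dependence of
  the points.\<close>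

lemma inner_wedge_nonzero:
  assumes indep: "aff_dim (a ` {1..CARD('n)}) = int CARD('n) - 1"
    and "v \<noteq> 0" and orth: "\<And>i. i \<in> {1..CARD('n)} \<Longrightarrow> a i \<bullet> v = t"
  shows "v \<bullet> wedge a \<noteq> 0"
proof
  assume "v \<bullet> wedge a = 0"
  then have "orientation_det e v a = 0" by (simp add: orientation_det_eq_inner)
  then obtain c where c: "\<exists>i \<le> CARD('n). c i \<noteq> 0"
      "c 0 *\<^sub>R v + (\<Sum>i = 1..CARD('n). c i *\<^sub>R a i) = 0" "(\<Sum>i = 1..CARD('n). c i) = 0"
    unfolding orientation_det_eq_0_iff by blast
  have "0 = (c 0 *\<^sub>R v + (\<Sum>i = 1..CARD('n). c i *\<^sub>R a i)) \<bullet> v"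
    by (simp only: c(2) inner_zero_left)
  also have "\<dots> = c 0 * (v \<bullet> v) + (\<Sum>i = 1..CARD('n). c i * t)"
    using orth by (simp add: inner_add_left inner_sum_left)
  also have "\<dots> = c 0 * (v \<bullet> v)"
    using c(3) by (simp flip: sum_distrib_right)
  finally have c0: "c 0 = 0" using \<open>v \<noteq> 0\<close> by simp
  have "c i = 0" if "i \<in> {1..CARD('n)}" for i
  proof (rule affinely_independent_family[of "{1..CARD('n)}" a])
    show "(\<Sum>i = 1..CARD('n). c i *\<^sub>R a i) = 0" using c(2) c0 by simp
  qed (use indep c(3) that in auto)
  with c0 have "c i = 0" if "i \<le> CARD('n)" for i
    using that by (cases "i = 0") auto
  with c(1) show False by blast
qed

text \<open>The component of \<open>v\<close> orthogonal to \<open>wedge a\<close> is again constant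
  on the points, so it would have a nonzero product with \<open>wedge a\<close> if it were
  nonzero.\<close>

lemma normal_eq_scaleR_wedge:
  assumes indep: "aff_dim (a ` {1..CARD('n)}) = int CARD('n) - 1"
    and orth: "\<And>i. i \<in> {1..CARD('n)} \<Longrightarrow> a i \<bullet> v = t"
  shows "v = ((v \<bullet> wedge a) / (wedge a \<bullet> wedge a)) *\<^sub>R wedge a"
proof (rule ccontr)
  let ?W = "wedge a" and ?c = "(v \<bullet> wedge a) / (wedge a \<bullet> wedge a)"
  assume "\<not> ?thesis"
  then have "v - ?c *\<^sub>R ?W \<noteq> 0" by simp
  moreover have "a i \<bullet> (v - ?c *\<^sub>R ?W) = t - ?c * (a 1 \<bullet> ?W)" if "i \<in> {1..CARD('n)}" for i
    using inner_wedge_diff[of i 1 a] orth[OF that] that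
    by (simp add: inner_diff_left inner_diff_right)
  ultimately have "(v - ?c *\<^sub>R ?W) \<bullet> ?W \<noteq> 0"
    by (rule inner_wedge_nonzero[OF indep])
  moreover have "(v - ?c *\<^sub>R ?W) \<bullet> ?W = 0"
    by (cases "?W = 0") (simp_all add: inner_diff_left)
  ultimately show False by simp
qed

text \<open>By their dimension the points lie on some hyperplane, and its normal has a nonzero
  product with \<open>wedge a\<close>.\<close>

lemma wedge_nonzero:
  assumes indep: "aff_dim (a ` {1..CARD('n)}) = int CARD('n) - 1"
  shows "wedge a \<noteq> 0"
proof -
  obtain v t where "v \<noteq> 0" "a ` {1..CARD('n)} \<subseteq> {x. v \<bullet> x = t}"
    using aff_lowdim_subset_hyperplane[of "a ` {1..CARD('n)}"] indep by (auto simp: DIM_cart)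
  then have "a i \<bullet> v = t" if "i \<in> {1..CARD('n)}" for i
    using that by (subst inner_commute) blast
  then have "v \<bullet> wedge a \<noteq> 0"
    using \<open>v \<noteq> 0\<close> by (intro inner_wedge_nonzero[OF indep])
  then show ?thesis by auto
qed

text \<open>A hyperplane through the points contains their affine hull, so it suffices to test the
  points themselves.\<close>

lemma normal_of_affine_hull_iff:
  "(\<forall>x \<in> affine hull (a ` {1..CARD('n)}). \<forall>y \<in> affine hull (a ` {1..CARD('n)}). (x - y) \<bullet> v = 0)
    \<longleftrightarrow> (\<forall>i \<in> {1..CARD('n)}. a i \<bullet> v = a 1 \<bullet> v)"
proof (intro iffI ballI)
  fix i assume "\<forall>x \<in> affine hull (a ` {1..CARD('n)}). \<forall>y \<in> affine hull (a ` {1..CARD('n)}). (x - y) \<bullet> v = 0"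
    and "i \<in> {1..CARD('n)}"
  moreover have "a i \<in> affine hull (a ` {1..CARD('n)})" "a 1 \<in> affine hull (a ` {1..CARD('n)})"
    using \<open>i \<in> _\<close> by (auto intro!: hull_inc)
  ultimately have "(a i - a 1) \<bullet> v = 0" by blast
  then show "a i \<bullet> v = a 1 \<bullet> v" by (simp add: inner_diff_left)
next
  fix x y assume *: "\<forall>i \<in> {1..CARD('n)}. a i \<bullet> v = a 1 \<bullet> v"
    and xy: "x \<in> affine hull (a ` {1..CARD('n)})" "y \<in> affine hull (a ` {1..CARD('n)})"
  have "v \<bullet> a i = a 1 \<bullet> v" if "i \<in> {1..CARD('n)}" for i
    using bspec[OF * that] by (simp only: inner_commute)
  then have "a ` {1..CARD('n)} \<subseteq> {x. v \<bullet> x = a 1 \<bullet> v}" by blast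
  then have "affine hull (a ` {1..CARD('n)}) \<subseteq> {x. v \<bullet> x = a 1 \<bullet> v}"
    by (rule hull_minimal) (rule affine_hyperplane)
  then have "v \<bullet> x = a 1 \<bullet> v" "v \<bullet> y = a 1 \<bullet> v" using xy by blast+
  then show "(x - y) \<bullet> v = 0" by (simp add: inner_diff_right inner_commute[of _ v])
qed

text \<open>Every normal is a multiple of \<open>wedge a\<close>; unit length and the sign condition
  leave only the factor \<open>inverse (norm (wedge a))\<close>. This is the uniqueness that the
  definite description requires.\<close>

lemma positive_normal_eqI:
  assumes indep: "aff_dim (a ` {1..CARD('n)}) = int CARD('n) - 1"
    and "norm v = 1" and orth: "\<And>i. i \<in> {1..CARD('n)} \<Longrightarrow> a i \<bullet> v = t" and pos: "0 < v \<bullet> wedge a"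
  shows "positive_normal e a = v"
proof -
  let ?W = "wedge a"
  have unit: "u = ?W /\<^sub>R norm ?W"
    if "norm u = 1" "\<And>i. i \<in> {1..CARD('n)} \<Longrightarrow> a i \<bullet> u = s" "0 < u \<bullet> ?W" for u s
  proof -
    define c where "c = (u \<bullet> ?W) / (?W \<bullet> ?W)"
    have u: "u = c *\<^sub>R ?W"
      unfolding c_def by (rule normal_eq_scaleR_wedge[OF indep that(2)])
    have "?W \<noteq> 0" using that(3) by auto
    then have "0 < c" using that(3) by (simp add: c_def)
    moreover have "1 = \<bar>c\<bar> * norm ?W" using that(1) u by (metis norm_scaleR)
    ultimately have "c = inverse (norm ?W)" using \<open>?W \<noteq> 0\<close> by (simp add: field_simps)
    then show ?thesis using u by simp
  qed
  show ?thesis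
    unfolding positive_normal_def normal_of_affine_hull_iff orientation_det_eq_inner
  proof (rule the_equality)
    show "norm v = 1 \<and> (\<forall>i\<in>{1..CARD('n)}. a i \<bullet> v = a 1 \<bullet> v) \<and> 0 < v \<bullet> ?W"
    proof (intro conjI ballI)
      fix i assume "i \<in> {1..CARD('n)}"
      then show "a i \<bullet> v = a 1 \<bullet> v" using orth[of i] orth[of 1] by simp
    qed (fact assms(2) pos)+
    show "u = v" if "norm u = 1 \<and> (\<forall>i\<in>{1..CARD('n)}. a i \<bullet> u = a 1 \<bullet> u) \<and> 0 < u \<bullet> ?W" for u
      using unit[of u "a 1 \<bullet> u"] unit[OF \<open>norm v = 1\<close> orth pos] that by blast
  qed
qed

lemma positive_normal_wedge:
  assumes indep: "aff_dim (a ` {1..CARD('n)}) = int CARD('n) - 1"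
  shows "positive_normal e a = wedge a /\<^sub>R norm (wedge a)"
proof (rule positive_normal_eqI[OF indep])
  have W: "wedge a \<noteq> 0" using wedge_nonzero[OF indep] .
  then show "norm (wedge a /\<^sub>R norm (wedge a)) = 1" "0 < (wedge a /\<^sub>R norm (wedge a)) \<bullet> wedge a"
    by simp_all
  show "a i \<bullet> (wedge a /\<^sub>R norm (wedge a)) = a 1 \<bullet> (wedge a /\<^sub>R norm (wedge a))"
    if "i \<in> {1..CARD('n)}" for i
    using inner_wedge_diff[of i 1 a] that by (simp add: inner_diff_left)
qed

text \<open>By the Leibniz formula each component is a polynomial in the coordinates of the
  points.\<close>

lemma continuous_on_wedge:
  fixes f :: "'b::topological_space \<Rightarrow> nat \<Rightarrow> real ^ 'n"
  assumes "\<And>i. i \<in> {1..CARD('n)} \<Longrightarrow> continuous_on S (\<lambda>y. f y i)"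
  shows "continuous_on S (\<lambda>y. wedge (f y))"
proof -
  have "continuous_on S (\<lambda>y. orientation_det e v (f y))" for v
    unfolding orientation_det_eq det_def'[OF orientation_mat_carrier]
  proof (intro continuous_on_sum continuous_on_mult continuous_on_const continuous_on_prod)
    fix p r assume "p \<in> {p. p permutes {0..<CARD('n) + 1}}" "r \<in> {0..<CARD('n) + 1}"
    then have "p r < CARD('n) + 1" "r < CARD('n) + 1"
      using permutes_in_image[of p "{0..<CARD('n) + 1}" r] by auto
    then show "continuous_on S (\<lambda>y. orientation_mat v (f y) $$ (r, p r))"
      using assms[of "p r"]
      by (cases "p r = 0"; cases "r < CARD('n)")
         (auto simp: orientation_mat_def intro!: continuous_intros continuous_on_component)
  qed
  then show ?thesis unfolding wedge_def by (intro continuous_on_vec_lambda)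
qed

end

section \<open>Choices of one point from each support\<close>

locale separated_supports = coordinate_order e for e :: "nat \<Rightarrow> 'n::finite" +
  fixes \<mu> :: "nat \<Rightarrow> (real ^ 'n) measure"
  assumes nice_measures: "i \<in> {1..CARD('n)} \<Longrightarrow> nice_measure (\<mu> i)"
    and separated: "well_separated {1..CARD('n)} (\<lambda>i. support (\<mu> i))"
begin

abbreviation K :: "nat \<Rightarrow> (real ^ 'n) set" where
  "K i \<equiv> support (\<mu> i)"

lemma nice: "i \<in> {1..CARD('n)} \<Longrightarrow> nice (\<mu> i)"
  using nice_measures by (simp add: nice_def)

text \<open>The instance of separation for the full index set; it makes \<open>wedge a\<close>
  nonzero for every choice of points from the supports.\<close>

lemma aff_dim_transversal:
  assumes "\<And>i. i \<in> {1..CARD('n)} \<Longrightarrow> a i \<in> K i"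
  shows "aff_dim (a ` {1..CARD('n)}) = int CARD('n) - 1"
proof -
  have "\<forall>j \<in> {1..CARD('n)}. a j \<in> convex hull K j"
    using assms by (auto intro: hull_inc)
  then have "aff_dim (affine hull (a ` {1..CARD('n)})) = int (card {1..CARD('n)}) - 1"
    using separated unfolding well_separated_def
    by (elim conjE allE[where x = "{1..CARD('n)}"] allE[where x = a]) auto
  then show ?thesis by simp
qed

text \<open>The product of the supports, encoded as vectors of vectors so that it is a subset of a
  Euclidean space, as Brouwer's theorem requires.\<close>

definition choices :: "(real ^ 'n ^ 'n) set" where
  "choices = {x. \<forall>k. x $ k \<in> K (index k)}"

lemma choices_D: "x \<in> choices \<Longrightarrow> i \<in> {1..CARD('n)} \<Longrightarrow> x $ e i \<in> K i"
  using index_e by (simp add: choices_def) metis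

lemma choices_I:
  assumes "\<And>i. i \<in> {1..CARD('n)} \<Longrightarrow> a i \<in> K i"
  shows "(\<chi> k. a (index k)) \<in> choices"
  using assms index by (simp add: choices_def)

lemma compact_choices: "compact choices"
  unfolding choices_def by (intro compact_vec_product nice.compact_support nice index)

lemma convex_choices: "convex choices"
  unfolding choices_def using nice.convex_support[OF nice[OF index(1)]]
  by (simp add: convex_def)

lemma choices_nonempty: "choices \<noteq> {}"
proof -
  have "\<forall>i \<in> {1..CARD('n)}. \<exists>y. y \<in> K i"
    using nice.support_nonempty[OF nice] by blast
  then obtain a where "\<And>i. i \<in> {1..CARD('n)} \<Longrightarrow> a i \<in> K i" by metis
  then show ?thesis using choices_I by blast
qed

text \<open>Trades the definite description of the normal for the inequality
  \<open>0 < v \<bullet> wedge a\<close>, whose left side can be followed by continuity.\<close>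

lemma positive_transversal_halfspaceE:
  assumes "positive_transversal_halfspace e K H"
  obtains v t a where "norm v = 1" "H = lower_halfspace v t"
    "\<And>i. i \<in> {1..CARD('n)} \<Longrightarrow> a i \<in> K i" "\<And>i. i \<in> {1..CARD('n)} \<Longrightarrow> a i \<bullet> v = t"
    "0 < v \<bullet> wedge a"
proof -
  obtain v t a where *: "norm v = 1" "H = lower_halfspace v t"
    "\<forall>i \<in> {1..CARD('n)}. a i \<in> K i \<inter> hyperplane v t" "v = positive_normal e a"
    using assms unfolding positive_transversal_halfspace_def by blast
  then have a: "a i \<in> K i" "a i \<bullet> v = t" if "i \<in> {1..CARD('n)}" for i
    using that by (auto simp: hyperplane_def)
  have "v = wedge a /\<^sub>R norm (wedge a)" "wedge a \<noteq> 0"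
    using * positive_normal_wedge[OF aff_dim_transversal] wedge_nonzero[OF aff_dim_transversal] a by simp_all
  then have "0 < v \<bullet> wedge a" by simp
  then show ?thesis using that[OF *(1,2) a] by blast
qed

lemma positive_transversal_halfspaceI:
  assumes "norm v = 1" "\<And>i. i \<in> {1..CARD('n)} \<Longrightarrow> a i \<in> K i"
    "\<And>i. i \<in> {1..CARD('n)} \<Longrightarrow> a i \<bullet> v = t" "0 < v \<bullet> wedge a"
  shows "positive_transversal_halfspace e K (lower_halfspace v t)"
  unfolding positive_transversal_halfspace_def
proof (intro exI[of _ v] exI[of _ t] exI[of _ a] conjI ballI)
  show "transversal (hyperplane v t) {1..CARD('n)} K"
    using assms(2,3) unfolding transversal_def hyperplane_def by blast
  show "v = positive_normal e a"
    using positive_normal_eqI[OF aff_dim_transversal, of a v t] assms by simp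
  show "a i \<in> K i \<inter> hyperplane v t" if "i \<in> {1..CARD('n)}" for i
    using assms(2,3)[OF that] by (simp add: hyperplane_def)
qed (use assms(1) in auto)

section \<open>Existence by a Brouwer fixed point\<close>

lemma exists_halfspace:
  assumes \<alpha>: "\<And>i. i \<in> {1..CARD('n)} \<Longrightarrow> \<alpha> i \<in> {0..1}"
  shows "\<exists>H. positive_transversal_halfspace e K H \<and>
    (\<forall>i \<in> {1..CARD('n)}. measure (\<mu> i) (K i \<inter> H) = \<alpha> i * measure (\<mu> i) (K i))"
proof -
  define N where "N x = wedge (\<lambda>i. x $ e i) /\<^sub>R norm (wedge (\<lambda>i. x $ e i))" for x :: "real ^ 'n ^ 'n"
  define c where "c k x = \<alpha> (index k) * measure (\<mu> (index k)) UNIV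
      - measure (\<mu> (index k)) (lower_halfspace (N x) (x $ k \<bullet> N x))" for k x
  \<comment> \<open>At a fixed point with \<open>c k x > 0\<close> (resp. \<open>< 0\<close>) the point \<open>x $ k\<close> maximises (resp. minimises)
    \<open>N x\<close> over its support, which contradicts \<open>0 \<le> \<alpha> \<le> 1\<close>; hence all \<open>c k x\<close> vanish.\<close>
  define F where "F x = (\<chi> k. closest_point (K (index k)) (x $ k + c k x *\<^sub>R N x))" for x
  have W: "wedge (\<lambda>i. x $ e i) \<noteq> 0" if "x \<in> choices" for x
    by (intro wedge_nonzero aff_dim_transversal choices_D that)
  have N1: "norm (N x) = 1" if "x \<in> choices" for x
    using W[OF that] by (simp add: N_def)
  then have N0: "N x \<noteq> 0" if "x \<in> choices" for x
    using that by fastforce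
  have contN: "continuous_on choices N"
    unfolding N_def by (intro continuous_intros continuous_on_wedge) (use W in auto)
  have contk: "continuous_on choices (\<lambda>x. x $ k)" for k
    by (intro continuous_intros)
  have "continuous_on choices F"
    unfolding F_def
  proof (intro continuous_on_vec_lambda)
    fix k
    interpret nice "\<mu> (index k)" by (rule nice[OF index(1)])
    have "continuous_on choices (c k)"
      unfolding c_def
      by (intro continuous_intros continuous_on_measure_lower_halfspace contN contk N0)
    then have "continuous_on choices (\<lambda>x. x $ k + c k x *\<^sub>R N x)"
      by (intro continuous_intros contN contk)
    then show "continuous_on choices (\<lambda>x. closest_point (K (index k)) (x $ k + c k x *\<^sub>R N x))"
      using convex_support closed_support support_nonempty
      by (intro continuous_on_compose2[OF continuous_on_closest_point[of "K (index k)" UNIV]]) auto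
  qed
  moreover have "F \<in> choices \<rightarrow> choices"
  proof
    fix x
    have "closest_point (K (index k)) y \<in> K (index k)" for k y
      using nice.closed_support[OF nice[OF index(1)]] nice.support_nonempty[OF nice[OF index(1)]]
      by (rule closest_point_in_set)
    then show "F x \<in> choices" by (simp add: choices_def F_def)
  qed
  ultimately obtain x where x: "x \<in> choices" "F x = x"
    by (rule brouwer[OF compact_choices convex_choices choices_nonempty, of F])
  define v where "v = N x"
  define a where "a i = x $ e i" for i
  define t where "t = a 1 \<bullet> v"
  have v: "norm v = 1" using N1[OF x(1)] by (simp add: v_def)
  have a: "a i \<in> K i" if "i \<in> {1..CARD('n)}" for i
    using choices_D[OF x(1) that] by (simp add: a_def)
  have vW: "v = wedge a /\<^sub>R norm (wedge a)"
    by (simp add: v_def N_def a_def[abs_def])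
  \<comment> \<open>Since \<open>wedge a\<close> is normal to the differences of the points, the
    halfspaces used in the components of \<open>F\<close> all have the same bounding
    hyperplane.\<close>
  have at: "a i \<bullet> v = t" if "i \<in> {1..CARD('n)}" for i
  proof -
    have "(a i - a 1) \<bullet> v = 0"
      using inner_wedge_diff[of i 1 a] that by (simp add: vW)
    then show ?thesis by (simp add: t_def inner_diff_left)
  qed
  have "0 < v \<bullet> wedge a" using W[OF x(1)] by (simp add: vW a_def[abs_def])
  then have "positive_transversal_halfspace e K (lower_halfspace v t)"
    by (intro positive_transversal_halfspaceI[OF v a at])
  moreover have "measure (\<mu> i) (K i \<inter> lower_halfspace v t) = \<alpha> i * measure (\<mu> i) (K i)"
    if i: "i \<in> {1..CARD('n)}" for i
  proof -
    interpret nice "\<mu> i" by (rule nice[OF i])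
    let ?M = "measure (\<mu> i) UNIV" and ?m = "measure (\<mu> i) (lower_halfspace v t)"
    define \<delta> where "\<delta> = \<alpha> i * ?M - ?m"
    have fixed: "closest_point (K i) (a i + \<delta> *\<^sub>R v) = a i"
      using arg_cong[OF x(2), of "\<lambda>y. y $ e i"] index_e[OF i] at[OF i]
      by (simp add: F_def c_def \<delta>_def a_def v_def)
    \<comment> \<open>A point outside a closed convex set leaves its projection in a direction of
      the normal cone; here that direction is \<open>\<delta> *\<^sub>R v\<close> at
      \<open>a i\<close>.\<close>
    have le: "\<delta> * (y \<bullet> v) \<le> \<delta> * t" if "y \<in> K i" for y
    proof -
      have "((a i + \<delta> *\<^sub>R v) - a i) \<bullet> (y - a i) \<le> 0"
        using closest_point_dot[OF convex_support closed_support that, of "a i + \<delta> *\<^sub>R v"]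
        by (simp add: fixed)
      then show ?thesis using at[OF i]
        by (simp add: inner_diff_right inner_commute[of v] right_diff_distrib)
    qed
    have \<alpha>i: "0 \<le> \<alpha> i * ?M" "\<alpha> i * ?M \<le> ?M"
      using \<alpha>[OF i] measure_UNIV_pos by (auto simp: mult_le_cancel_right1)
    have "\<delta> = 0"
    proof (rule linorder_cases[of \<delta> 0])
      assume "\<delta> < 0"
      then have ge: "t \<le> y \<bullet> v" if "y \<in> K i" for y
        using le[OF that] by simp
      have "?m = measure (\<mu> i) {}"
      proof (rule measure_eq_AE)
        have "v \<noteq> 0" using v by auto
        \<comment> \<open>The closed halfspace still contains the support points with
          \<open>y \<bullet> v = t\<close>, such as \<open>a i\<close>; they are negligible because
          hyperplanes are null.\<close>
        from AE_not_hyperplane[OF this, of t] AE_support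
        show "AE y in \<mu> i. y \<in> lower_halfspace v t \<longleftrightarrow> y \<in> {}"
          by eventually_elim (use ge in \<open>force simp: lower_halfspace_def\<close>)
      qed (auto simp: lower_halfspace_def)
      then show ?thesis using \<open>\<delta> < 0\<close> \<alpha>i by (simp add: \<delta>_def)
    next
      assume "0 < \<delta>"
      then have ge: "y \<bullet> v \<le> t" if "y \<in> K i" for y
        using le[OF that] by simp
      have "?m = ?M"
      proof (rule measure_eq_AE)
        from AE_support show "AE y in \<mu> i. y \<in> lower_halfspace v t \<longleftrightarrow> y \<in> UNIV"
          by eventually_elim (use ge in \<open>force simp: lower_halfspace_def\<close>)
      qed (auto simp: lower_halfspace_def)
      then show ?thesis using \<open>0 < \<delta>\<close> \<alpha>i by (simp add: \<delta>_def)
    qed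
    then show ?thesis
      by (subst measure_support_Int) (auto simp: measure_support \<delta>_def lower_halfspace_def)
  qed
  ultimately show ?thesis by blast
qed

section \<open>Uniqueness by a pencil of hyperplanes\<close>

lemma halfspace_unique:
  assumes H: "positive_transversal_halfspace e K H" and H': "positive_transversal_halfspace e K H'"
    and eq: "\<And>i. i \<in> {1..CARD('n)} \<Longrightarrow> measure (\<mu> i) (K i \<inter> H) = measure (\<mu> i) (K i \<inter> H')"
  shows "H = H'"
proof (rule ccontr)
  assume "H \<noteq> H'"
  obtain v t a where v: "norm v = 1" "H = lower_halfspace v t"
    and a: "\<And>i. i \<in> {1..CARD('n)} \<Longrightarrow> a i \<in> K i" "\<And>i. i \<in> {1..CARD('n)} \<Longrightarrow> a i \<bullet> v = t"
    and va: "0 < v \<bullet> wedge a"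
    using positive_transversal_halfspaceE[OF H] by metis
  obtain u s b where u: "norm u = 1" "H' = lower_halfspace u s"
    and b: "\<And>i. i \<in> {1..CARD('n)} \<Longrightarrow> b i \<in> K i" "\<And>i. i \<in> {1..CARD('n)} \<Longrightarrow> b i \<bullet> u = s"
    and ub: "0 < u \<bullet> wedge b"
    using positive_transversal_halfspaceE[OF H'] by metis
  have "v \<noteq> 0" "u \<noteq> 0" using v u by auto
  have eq': "measure (\<mu> i) (lower_halfspace v t) = measure (\<mu> i) (lower_halfspace u s)"
    if "i \<in> {1..CARD('n)}" for i
    using eq[OF that] by (simp add: v u nice.measure_support_Int[OF nice[OF that]] lower_halfspace_def)
  have P: "\<exists>p \<in> K i. t \<le> p \<bullet> v \<and> p \<bullet> u \<le> s" if "i \<in> {1..CARD('n)}" for i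
    by (rule nice.exists_support_between[OF nice[OF that] \<open>v \<noteq> 0\<close> \<open>u \<noteq> 0\<close>
          a(1)[OF that] a(2)[OF that] b(1)[OF that] b(2)[OF that] eq'[OF that]])
  have Q: "\<exists>q \<in> K i. s \<le> q \<bullet> u \<and> q \<bullet> v \<le> t" if "i \<in> {1..CARD('n)}" for i
    by (rule nice.exists_support_between[OF nice[OF that] \<open>u \<noteq> 0\<close> \<open>v \<noteq> 0\<close>
          b(1)[OF that] b(2)[OF that] a(1)[OF that] a(2)[OF that] eq'[OF that, symmetric]])
  \<comment> \<open>A pencil of hyperplanes from the one bounding \<open>H\<close> to the one bounding \<open>H'\<close>, the latter with reversed normal.\<close>
  define n where "n l = (1 - l) *\<^sub>R v - l *\<^sub>R u" for l :: real
  define r where "r l = (1 - l) * t - l * s" for l :: real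
  define w where "w x = wedge (\<lambda>i. x $ e i)" for x :: "real ^ 'n ^ 'n"
  define Z where "Z l = {x \<in> choices. \<forall>i \<in> {1..CARD('n)}. x $ e i \<bullet> n l = r l}" for l
  have w_vec: "w (\<chi> k. a (index k)) = wedge a" for a
    unfolding w_def by (rule wedge_cong) (simp add: index_e)
  \<comment> \<open>Since \<open>v\<close> and \<open>u\<close> are unit vectors, the normal can
    vanish only for \<open>l = 1 / 2\<close> and \<open>v = u\<close>; then \<open>P\<close> and
    \<open>Q\<close> give \<open>t = s\<close>, so the halfspaces coincide.\<close>
  have n_nonzero: "n l \<noteq> 0" if "l \<in> {0..1}" for l
  proof
    assume "n l = 0"
    then have *: "(1 - l) *\<^sub>R v = l *\<^sub>R u" by (simp add: n_def)
    then have "\<bar>1 - l\<bar> = \<bar>l\<bar>" using v(1) u(1) by (metis norm_scaleR mult.right_neutral)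
    then have "l = 1 / 2" using that by auto
    then have "1 - l = l" by simp
    then have "l *\<^sub>R v = l *\<^sub>R u" using * by metis
    then have "v = u" using \<open>l = 1 / 2\<close> by simp
    then have "t = s" using P[of 1] Q[of 1] by fastforce
    with \<open>v = u\<close> show False using \<open>H \<noteq> H'\<close> v u by simp
  qed
  have Z_nonempty: "Z l \<noteq> {}" if l: "l \<in> {0..1}" for l
  proof -
    have "\<exists>y \<in> K i. y \<bullet> n l = r l" if i: "i \<in> {1..CARD('n)}" for i
    proof -
      \<comment> \<open>The points \<open>p\<close> and \<open>q\<close> lie on opposite closed
        sides of every hyperplane of the pencil, so the connected support meets it.\<close>
      obtain p q where pq: "p \<in> K i" "t \<le> p \<bullet> v" "p \<bullet> u \<le> s" "q \<in> K i" "s \<le> q \<bullet> u" "q \<bullet> v \<le> t"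
        using P[OF i] Q[OF i] by blast
      have "(1 - l) * t \<le> (1 - l) * (p \<bullet> v)" "l * (p \<bullet> u) \<le> l * s"
        "l * s \<le> l * (q \<bullet> u)" "(1 - l) * (q \<bullet> v) \<le> (1 - l) * t"
        using pq l by (auto intro!: mult_left_mono)
      then have "n l \<bullet> q \<le> r l" "r l \<le> n l \<bullet> p"
        unfolding n_def r_def inner_commute[of _ p] inner_commute[of _ q]
        by (simp_all only: inner_diff_right inner_scaleR_right)
      from connected_ivt_hyperplane[OF convex_connected[OF nice.convex_support[OF nice[OF i]]] pq(4,1) this]
      show ?thesis by (simp only: inner_commute)
    qed
    then obtain y where "\<And>i. i \<in> {1..CARD('n)} \<Longrightarrow> y i \<in> K i \<and> y i \<bullet> n l = r l" by metis
    then have "(\<chi> k. y (index k)) \<in> Z l"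
      using choices_I[of y] by (simp add: Z_def index_e)
    then show ?thesis by blast
  qed
  have Z_sign: "n l \<bullet> w x \<noteq> 0" if "l \<in> {0..1}" "x \<in> Z l" for l x
    unfolding w_def using that n_nonzero
    by (intro inner_wedge_nonzero[where t = "r l"] aff_dim_transversal choices_D) (auto simp: Z_def)
  have cont_w: "continuous_on S (\<lambda>z. w (f z))" if "continuous_on S f"
    for S and f :: "'c::topological_space \<Rightarrow> real ^ 'n ^ 'n"
    unfolding w_def by (intro continuous_on_wedge continuous_on_component that)
  \<comment> \<open>For fixed \<open>l\<close> the set \<open>Z l\<close> is convex, so a change of
    sign on it would force a zero. Hence the sign depends on \<open>l\<close> only.\<close>
  have no_change: False if "l \<in> {0..1}" "x \<in> Z l" "y \<in> Z l" "0 \<le> n l \<bullet> w x" "n l \<bullet> w y \<le> 0" for l x y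
  proof -
    have "convex (Z l)"
      using convex_choices unfolding Z_def convex_def by (auto simp: inner_add_left simp flip: distrib_right)
    then have "connected ((\<lambda>x. n l \<bullet> w x) ` Z l)"
      by (intro connected_continuous_image convex_connected continuous_intros cont_w)
    then have "0 \<in> (\<lambda>x. n l \<bullet> w x) ` Z l"
      using that connected_contains_Icc[of "(\<lambda>x. n l \<bullet> w x) ` Z l" "n l \<bullet> w y" "n l \<bullet> w x"] by force
    then show False using Z_sign[OF that(1)] by force
  qed
  \<comment> \<open>The graph of \<open>Z\<close> over the unit interval; its compactness makes
    projections of closed parts to the parameter \<open>l\<close> closed.\<close>
  define T where "T = {z \<in> {0..1} \<times> choices. snd z \<in> Z (fst z)}"
  have "compact T"
  proof -
    have "closed (\<Inter>i \<in> {1..CARD('n)}. {z. snd z $ e i \<bullet> n (fst z) = r (fst z)})"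
      unfolding n_def r_def by (intro closed_INT ballI closed_Collect_eq continuous_intros)
    then have "compact (({0..1} \<times> choices) \<inter> (\<Inter>i \<in> {1..CARD('n)}. {z. snd z $ e i \<bullet> n (fst z) = r (fst z)}))"
      by (intro compact_Int_closed compact_Times compact_Icc compact_choices)
    also have "({0..1} \<times> choices) \<inter> (\<Inter>i \<in> {1..CARD('n)}. {z. snd z $ e i \<bullet> n (fst z) = r (fst z)}) = T"
      by (auto simp: T_def Z_def)
    finally show ?thesis .
  qed
  \<comment> \<open>\<open>A\<close> and \<open>B\<close> collect the parameters with a nonnegative,
    respectively nonpositive, product at some point of \<open>Z l\<close>. They are closed, cover
    the unit interval and are disjoint there, so by connectedness one of them misses it.\<close>
  define A where "A = fst ` (T \<inter> {z. 0 \<le> n (fst z) \<bullet> w (snd z)})"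
  define B where "B = fst ` (T \<inter> {z. n (fst z) \<bullet> w (snd z) \<le> 0})"
  have cont: "continuous_on UNIV (\<lambda>z. n (fst z) \<bullet> w (snd z))"
    unfolding n_def by (intro continuous_intros cont_w)
  have "closed A" "closed B"
    unfolding A_def B_def
    by (intro compact_imp_closed compact_continuous_image compact_Int_closed \<open>compact T\<close>
        closed_Collect_le cont continuous_intros)+
  moreover have "{0..1} \<subseteq> A \<union> B"
  proof
    fix l :: real assume l: "l \<in> {0..1}"
    then obtain x where "x \<in> Z l" using Z_nonempty by blast
    then have "(l, x) \<in> T" using l by (auto simp: T_def Z_def)
    then show "l \<in> A \<union> B" unfolding A_def B_def by (force simp: image_iff)
  qed
  moreover have "A \<inter> B \<inter> {0..1} = {}"
    using no_change by (force simp: A_def B_def T_def)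
  ultimately have "A \<inter> {0..1} = {} \<or> B \<inter> {0..1} = {}"
    by (intro connected_closedD[OF connected_Icc]) auto
  moreover have "0 \<in> A"
  proof -
    have "(0, \<chi> k. a (index k)) \<in> T"
      using a choices_I[of a] by (simp add: T_def Z_def n_def r_def index_e)
    then show ?thesis
      unfolding A_def using va w_vec[of a] by (force simp: image_iff n_def)
  qed
  \<comment> \<open>As \<open>n 1 = - u\<close>, the positive orientation of \<open>b\<close> turns
    into a negative product.\<close>
  moreover have "1 \<in> B"
  proof -
    have "(1, \<chi> k. b (index k)) \<in> T"
      using b choices_I[of b] by (simp add: T_def Z_def n_def r_def index_e)
    then show ?thesis
      unfolding B_def using ub w_vec[of b] by (force simp: image_iff n_def)
  qed
  ultimately show False by auto
qed

end

theorem theorem3: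
  fixes e :: "nat \<Rightarrow> 'n::finite"
    and \<mu> :: "nat \<Rightarrow> (real ^ 'n) measure"
    and \<alpha> :: "nat \<Rightarrow> real"
  assumes "bij_betw e {1..CARD('n)} UNIV"
    and "\<And>i. i \<in> {1..CARD('n)} \<Longrightarrow> nice_measure (\<mu> i)"
    and "well_separated {1..CARD('n)} (\<lambda>i. support (\<mu> i))"
    and "\<And>i. i \<in> {1..CARD('n)} \<Longrightarrow> \<alpha> i \<in> {0..1}"
  shows "\<exists>!H. positive_transversal_halfspace e (\<lambda>i. support (\<mu> i)) H \<and>
           (\<forall>i \<in> {1..CARD('n)}.
              measure (\<mu> i) (support (\<mu> i) \<inter> H) = \<alpha> i * measure (\<mu> i) (support (\<mu> i)))"
proof -
  interpret separated_supports e \<mu>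
    by unfold_locales (use assms in auto)
  show ?thesis
  proof (rule ex_ex1I)
    show "\<exists>H. positive_transversal_halfspace e K H \<and>
        (\<forall>i \<in> {1..CARD('n)}. measure (\<mu> i) (K i \<inter> H) = \<alpha> i * measure (\<mu> i) (K i))"
      by (rule exists_halfspace[OF assms(4)])
  next
    fix H H'
    assume *: "positive_transversal_halfspace e K H \<and>
        (\<forall>i \<in> {1..CARD('n)}. measure (\<mu> i) (K i \<inter> H) = \<alpha> i * measure (\<mu> i) (K i))"
      "positive_transversal_halfspace e K H' \<and>
        (\<forall>i \<in> {1..CARD('n)}. measure (\<mu> i) (K i \<inter> H') = \<alpha> i * measure (\<mu> i) (K i))"
    show "H = H'"
    proof (rule halfspace_unique)
      show "measure (\<mu> i) (K i \<inter> H) = measure (\<mu> i) (K i \<inter> H')" if "i \<in> {1..CARD('n)}" for i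
        using * that by metis
    qed (use * in blast)+
  qed
qed

end
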